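(* For every integer $n\ge1$, the Zagier polynomials satisfy the duplication formula $$2B_n^{*}(2x)=(B^{*}\circ E)_n(2x)+(B^{*}\circ E)_n(2x+1),$$ where $(B^{*}\circ E)_n$ is the umbral composition of the Zagier polynomials with the Euler polynomials.
   Context: The Bernoulli polynomials $B_r(x)$ are defined by $\frac{te^{xt}}{e^t-1}=\sum_{r=0}^\infty B_r(x)\frac{t^r}{r!}$. For an integer $n>0$ the Zagier polynomial is $B_n^{*}(x)=\sum_{r=0}^{n}\binom{n+r}{2r}\frac{B_r(x)}{n+r}$. The Euler polynomials $E_k(x)$ are defined by $\frac{2e^{tx}}{e^t+1}=\sum_{k=0}^\infty E_k(x)\frac{t^k}{k!}$. Given two sequences of polynomials $P=\{P_n(x)\}$ and $Q=\{Q_n(x)\}$, their umbral composition is $(P\circ Q)_n(x)=\sum_{k=0}^{n}p_{k,n}Q_k(x)$, where $p_{k,n}$ is the coefficient of $x^k$ in $P_n(x)$. Thus $(B^{*}\circ E)_n(x)=\sum_{k=0}^n b_{k,n}E_k(x)$ with $b_{k,n}$ the coefficient of $x^k$ in $B_n^{*}(x)$. *)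

theory Defs
  imports "HOL-Computational_Algebra.Computational_Algebra"
begin

text \<open>
  Power series in \<open>t\<close> whose coefficients are polynomials in \<open>x\<close> have type \<open>'a poly fps\<close>.
  As \<open>'a poly\<close> is not a field, the quotients \<open>t / (e\<^sup>t - 1)\<close> and \<open>2 / (e\<^sup>t + 1)\<close> are
  formed in \<open>'a fps\<close> and then embedded coefficientwise; the two lemmas named
  \<open>generating_function\<close> recover the defining identities at every value of \<open>x\<close>.
\<close>

definition fps_lift_poly :: "'a::field_char_0 fps \<Rightarrow> 'a poly fps" where
  "fps_lift_poly f = Abs_fps (\<lambda>n. [:fps_nth f n:])"

definition fps_exp_xt :: "'a::field_char_0 poly fps" where
  "fps_exp_xt = Abs_fps (\<lambda>n. monom (1 / fact n) n)"

definition bernoulli_poly :: "nat \<Rightarrow> 'a::field_char_0 poly" where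
  "bernoulli_poly r =
     smult (fact r) (fps_nth (fps_lift_poly (fps_X / (fps_exp 1 - 1)) * fps_exp_xt) r)"

definition euler_poly :: "nat \<Rightarrow> 'a::field_char_0 poly" where
  "euler_poly k =
     smult (fact k) (fps_nth (fps_lift_poly (2 / (fps_exp 1 + 1)) * fps_exp_xt) k)"

text \<open>Meant for \<open>n > 0\<close> only: for \<open>n = 0\<close> the denominator \<open>n + r\<close> vanishes.\<close>

definition zagier_poly :: "nat \<Rightarrow> 'a::field_char_0 poly" where
  "zagier_poly n =
     (\<Sum>r=0..n. smult (of_nat ((n + r) choose (2 * r)) / of_nat (n + r)) (bernoulli_poly r))"

definition umbral_comp ::
  "(nat \<Rightarrow> 'a::field_char_0 poly) \<Rightarrow> (nat \<Rightarrow> 'a poly) \<Rightarrow> nat \<Rightarrow> 'a poly" where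
  "umbral_comp P Q n = (\<Sum>k=0..n. smult (coeff (P n) k) (Q k))"

lemma poly_lift_mult_exp_xt:
  "poly (fps_nth (fps_lift_poly f * fps_exp_xt) n) x = fps_nth (f * fps_exp x) n"
  by (simp add: fps_mult_nth fps_lift_poly_def fps_exp_xt_def poly_sum poly_monom)

lemma bernoulli_poly_generating_function:
  fixes x :: "'a::field_char_0"
  shows "Abs_fps (\<lambda>r. poly (bernoulli_poly r) x / fact r) = fps_X * fps_exp x / (fps_exp 1 - 1)"
proof -
  have dvd: "(fps_exp 1 - 1 :: 'a fps) dvd fps_X"
  proof (rule fps_dvd_iff [THEN iffD2])
    have nz: "fps_nth (fps_exp 1 - 1 :: 'a fps) 1 \<noteq> 0" by simp
    then show "fps_exp 1 - 1 \<noteq> (0 :: 'a fps)" by (metis fps_zero_nth)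
    show "fps_X \<noteq> (0 :: 'a fps)" by simp
    show "subdegree (fps_exp 1 - 1 :: 'a fps) \<le> subdegree (fps_X :: 'a fps)"
      using subdegree_leI [OF nz] by simp
  qed
  have "fps_X * fps_exp x / (fps_exp 1 - 1) = fps_X / (fps_exp 1 - 1) * fps_exp x"
    using dvd by (simp add: dvd_div_mult)
  then show ?thesis
    by (simp add: fps_eq_iff bernoulli_poly_def poly_lift_mult_exp_xt)
qed

lemma euler_poly_generating_function:
  fixes x :: "'a::field_char_0"
  shows "Abs_fps (\<lambda>k. poly (euler_poly k) x / fact k) = 2 * fps_exp x / (fps_exp 1 + 1)"
proof -
  have "fps_nth (fps_exp 1 + 1 :: 'a fps) 0 \<noteq> 0" by simp
  then have dvd: "(fps_exp 1 + 1 :: 'a fps) dvd 2"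
    using fps_is_unit_iff unit_imp_dvd by blast
  have "2 * fps_exp x / (fps_exp 1 + 1) = 2 / (fps_exp 1 + 1) * fps_exp x"
    using dvd by (simp add: dvd_div_mult)
  then show ?thesis
    by (simp add: fps_eq_iff euler_poly_def poly_lift_mult_exp_xt)
qed

end

theory Submission
  imports Defs
begin

text \<open>
  Since \<open>2e\<^bsup>yt\<^esup>/(e\<^sup>t + 1) + 2e\<^bsup>(y + 1)t\<^esup>/(e\<^sup>t + 1) = 2e\<^bsup>yt\<^esup>\<close>, the Euler polynomials satisfy
  \<open>E\<^sub>k(y) + E\<^sub>k(y + 1) = 2y\<^sup>k\<close>. Hence \<open>(P \<circ> E)\<^sub>n(y) + (P \<circ> E)\<^sub>n(y + 1) = 2P\<^sub>n(y)\<close> for every sequence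
  of polynomials with \<open>deg P\<^sub>n \<le> n\<close>; duplication is the case \<open>y = 2x\<close> for the Zagier polynomials.
\<close>

lemma euler_poly_add_shift:
  fixes y :: "'a::field_char_0"
  shows "poly (euler_poly k) y + poly (euler_poly k) (y + 1) = 2 * y ^ k"
proof -
  let ?q = "2 / (fps_exp 1 + 1) :: 'a fps"
  \<comment> \<open>The constant term is 2, so \<open>fps_exp 1 + 1\<close> is a unit and the
    division in \<open>?q\<close> is exact.\<close>
  have "fps_nth (fps_exp 1 + 1 :: 'a fps) 0 \<noteq> 0" by simp
  then have "(fps_exp 1 + 1 :: 'a fps) dvd 2"
    using fps_is_unit_iff unit_imp_dvd by blast
  then have q: "?q * (fps_exp 1 + 1) = 2"
    by (rule dvd_div_mult_self)
  have "?q * fps_exp y + ?q * fps_exp (y + 1) = (?q * (fps_exp 1 + 1)) * fps_exp y"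
    by (simp add: fps_exp_add_mult algebra_simps)
  also have "\<dots> = fps_const 2 * fps_exp y"
    by (simp only: q) (simp only: numeral_fps_const)
  finally have "fps_nth (?q * fps_exp y + ?q * fps_exp (y + 1)) k = fps_nth (fps_const 2 * fps_exp y) k"
    by (rule arg_cong)
  then have "fps_nth (?q * fps_exp y) k + fps_nth (?q * fps_exp (y + 1)) k = 2 * (y ^ k / fact k)"
    by (simp only: fps_add_nth fps_exp_nth fps_mult_left_const_nth of_nat_fact)
  then show ?thesis
    \<comment> \<open>The factor \<open>fact k\<close> common to both Euler values is pulled out and
      cancels the denominator of \<open>y ^ k / fact k\<close>.\<close>
    by (simp only: euler_poly_def poly_smult poly_lift_mult_exp_xt flip: distrib_left) simp
qed

lemma umbral_comp_euler_add_shift: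
  fixes y :: "'a::field_char_0"
  assumes "degree (P n) \<le> n"
  shows "poly (umbral_comp P euler_poly n) y + poly (umbral_comp P euler_poly n) (y + 1) =
           2 * poly (P n) y"
proof -
  have "poly (umbral_comp P euler_poly n) y + poly (umbral_comp P euler_poly n) (y + 1) =
          (\<Sum>k\<le>n. coeff (P n) k * (2 * y ^ k))"
    by (simp add: umbral_comp_def poly_sum atLeast0AtMost
             flip: sum.distrib distrib_left euler_poly_add_shift)
  also have "\<dots> = 2 * poly (P n) y"
    \<comment> \<open>By the degree bound, the monomials up to \<open>n\<close> make up all of
      \<open>P n\<close>. Only the second occurrence is expanded; the first sits in
      \<open>coeff (P n) k\<close>.\<close>
    by (subst (2) poly_as_sum_of_monoms'[OF assms, symmetric])
       (simp add: poly_sum poly_monom sum_distrib_left mult_ac)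
  finally show ?thesis .
qed

text \<open>The lifted factor contributes only constants, so coefficient \<open>r\<close> of the
  product combines powers x^i with i \<le> r.\<close>

lemma degree_bernoulli_poly_le: "degree (bernoulli_poly r) \<le> r"
proof -
  have "degree (fps_nth (fps_lift_poly f * fps_exp_xt) r) \<le> r" for f :: "'a fps"
    unfolding fps_mult_nth fps_lift_poly_def fps_exp_xt_def
    by (intro degree_sum_le finite_atLeastAtMost) (simp add: degree_monom_eq)
  then show ?thesis
    unfolding bernoulli_poly_def by (rule order.trans[OF degree_smult_le])
qed

lemma degree_zagier_poly_le: "degree (zagier_poly n :: 'a::field_char_0 poly) \<le> n"
  unfolding zagier_poly_def
proof (intro degree_sum_le finite_atLeastAtMost)
  fix r assume "r \<in> {0..n}"
  then have "degree (bernoulli_poly r :: 'a poly) \<le> n"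
    using degree_bernoulli_poly_le[of r, where 'a = 'a] by simp
  then show "degree (smult (of_nat ((n + r) choose (2 * r)) / of_nat (n + r))
               (bernoulli_poly r :: 'a poly)) \<le> n"
    by (rule order.trans[OF degree_smult_le])
qed

theorem mainTheorem7:
  fixes n :: nat and x :: "'a::field_char_0"
  assumes "n \<ge> 1"
  shows "2 * poly (zagier_poly n) (2 * x) =
           poly (umbral_comp zagier_poly euler_poly n) (2 * x) +
           poly (umbral_comp zagier_poly euler_poly n) (2 * x + 1)"
  by (rule umbral_comp_euler_add_shift[where P = zagier_poly, OF degree_zagier_poly_le, symmetric])

end
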